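(* Let $G_1,G_2$ be connected graphs with $n\ge2$ and $m\ge2$ nodes and algebraic connectivities $\lambda_2^{(1)}>\lambda_2^{(2)}$. Let every node of $G_1$ be linked to every node of $G_2$ with the uniform weight $c/(nm)$, $c\ge0$, and let $L$ be the resulting supra-Laplacian. Say that super-diffusion occurs at budget $c$ if $\lambda_2[L]>\max(\lambda_2^{(1)},\lambda_2^{(2)})$. (i) Super-diffusion occurs for all sufficiently large $c$. (ii) Suppose either $n>m$ and $\lambda_2^{(1)}/n>\lambda_2^{(2)}/m$, or $n<m$; put $c^*=n\lambda_2^{(2)}$. Then super-diffusion occurs for some $c\le c^*$ if and only if $$\frac{\lambda_2^{(2)}}m<\frac{\lambda_2^{(1)}}n<\left(\frac1n+\frac1m\right)\lambda_2^{(2)}.$$ (iii) Suppose $n>m$ and $\lambda_2^{(1)}/n<\lambda_2^{(2)}/m$; put $c^*=m\lambda_2^{(1)}$. Then super-diffusion occurs for some $c\le c^*$ if and only if $$\frac{\lambda_2^{(1)}}n<\frac{\lambda_2^{(2)}}m<\left(\frac1n+\frac1m\right)\lambda_2^{(1)}.$$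
   Context: $G_1,G_2$ are finite undirected unweighted connected graphs with Laplacian matrices $L_1$ ($n\times n$) and $L_2$ ($m\times m$). The algebraic connectivity $\lambda_2[\cdot]$ of a Laplacian is its second smallest eigenvalue counted with multiplicity; $\lambda_2^{(k)}=\lambda_2[L_k]$. The supra-Laplacian with uniform all-to-all interlayer weights is $$L=\begin{bmatrix} L_1+\frac cn I_n & -\frac{c}{nm}\boldsymbol 1_n\boldsymbol 1_m^T\\ -\frac{c}{nm}\boldsymbol 1_m\boldsymbol 1_n^T & L_2+\frac cm I_m\end{bmatrix},$$ with $\boldsymbol 1_k$ the all-ones vector in $\mathbb R^k$ and $I_k$ the $k\times k$ identity. *)

theory Defs
  imports
    "HOL-Library.Multiset"
    "Graph_Theory.Digraph_Component"
    "Jordan_Normal_Form.Char_Poly"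
begin

text \<open>
  Undirected simple graphs are the symmetric loop-free digraphs without parallel arcs of
  \<^locale>\<open>graph\<close>. The nodes of a graph with \<open>n\<close> nodes are numbered \<open>0, ..., n - 1\<close>, so that
  they index the rows and columns of its matrices.
\<close>

definition adjacency_mat :: "nat \<Rightarrow> (nat, 'e) pre_digraph \<Rightarrow> real mat" where
  "adjacency_mat n G = mat n n (\<lambda>(i, j). if i \<rightarrow>\<^bsub>G\<^esub> j then 1 else 0)"

text \<open>
  An undirected edge is a pair of opposite arcs, so the out-degree of a node is its degree.
\<close>

definition degree_mat :: "nat \<Rightarrow> (nat, 'e) pre_digraph \<Rightarrow> real mat" where
  "degree_mat n G = mat n n (\<lambda>(i, j). if i = j then real (out_degree G i) else 0)"

definition laplacian :: "nat \<Rightarrow> (nat, 'e) pre_digraph \<Rightarrow> real mat" where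
  "laplacian n G = degree_mat n G - adjacency_mat n G"

text \<open>
  The eigenvalues counted with multiplicity, in increasing order, are the sorted roots of the
  characteristic polynomial. All matrices below are real symmetric, so no root is lost by
  taking the roots in the reals. List positions start at 0.
\<close>

definition eigenvalues_sorted :: "real mat \<Rightarrow> real list" where
  "eigenvalues_sorted A = sorted_list_of_multiset (proots (char_poly A))"

definition algebraic_connectivity :: "real mat \<Rightarrow> real" where
  "algebraic_connectivity A = eigenvalues_sorted A ! 1"

text \<open>The matrix \<open>ones_mat n m\<close> is the product of the all-ones column of length \<open>n\<close> and the
  all-ones row of length \<open>m\<close>.\<close>

definition ones_mat :: "nat \<Rightarrow> nat \<Rightarrow> real mat" where
  "ones_mat n m = mat n m (\<lambda>_. 1)"

definition supra_laplacian :: "real mat \<Rightarrow> real mat \<Rightarrow> real \<Rightarrow> real mat" where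
  "supra_laplacian L1 L2 c =
    (let n = dim_row L1; m = dim_row L2 in
      four_block_mat
        (L1 + (c / real n) \<cdot>\<^sub>m 1\<^sub>m n)                  (- (c / (real n * real m)) \<cdot>\<^sub>m ones_mat n m)
        (- (c / (real n * real m)) \<cdot>\<^sub>m ones_mat m n)   (L2 + (c / real m) \<cdot>\<^sub>m 1\<^sub>m m))"

definition super_diffusion :: "real mat \<Rightarrow> real mat \<Rightarrow> real \<Rightarrow> bool" where
  "super_diffusion L1 L2 c \<longleftrightarrow>
    algebraic_connectivity (supra_laplacian L1 L2 c)
      > max (algebraic_connectivity L1) (algebraic_connectivity L2)"

end

(* The vectors constant on each layer span an invariant plane of the supra-Laplacian, on which its
   eigenvalues are 0 and c/n + c/m. Modulo this plane the two layers decouple, so the remaining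
   eigenvalues are those of L1 and L2, with one zero removed from each, shifted by c/n and c/m.
   Hence lambda2[L] = min(c/n + c/m, lam1 + c/n, lam2 + c/m). This is nondecreasing in c, so
   super-diffusion occurs below a budget if and only if it occurs at that budget, and inserting
   c = n lam2 or c = m lam1 gives the inequalities. *)

theory Submission
  imports Defs
begin

section \<open>Change of basis adapted to a partition of the indices\<close>

lemma mult_mat_mat_index:
  assumes "A \<in> carrier_mat n n" "B \<in> carrier_mat n n" "i < n" "j < n"
  shows "(A * B) $$ (i, j) = (\<Sum>l<n. A $$ (i, l) * B $$ (l, j))"
  using assms by (simp add: scalar_prod_def lessThan_atLeast0)

text \<open>
  The map \<open>r\<close> sends each index to the representative of its cluster. The matrix \<open>lump_mat n r A\<close>
  represents \<open>A\<close> in the basis where the unit vector of each representative is replaced by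
  the indicator vector of its cluster.
\<close>

definition lump_entry :: "nat \<Rightarrow> (nat \<Rightarrow> nat) \<Rightarrow> real mat \<Rightarrow> nat \<Rightarrow> nat \<Rightarrow> real" where
  "lump_entry n r A i j = (if r j = j then \<Sum>l | l < n \<and> r l = j. A $$ (i, l) else A $$ (i, j))"

definition lump_mat :: "nat \<Rightarrow> (nat \<Rightarrow> nat) \<Rightarrow> real mat \<Rightarrow> real mat" where
  "lump_mat n r A = mat n n (\<lambda>(i, j).
     lump_entry n r A i j - (if r i = i then 0 else lump_entry n r A (r i) j))"

text \<open>Lumping is a similarity transform. Idempotence of \<open>r\<close> makes every
  representative represent itself, so the cluster indicators and the remaining unit vectors form a
  basis.\<close>

lemma char_poly_lump_mat:
  fixes A :: "real mat"
  assumes A: "A \<in> carrier_mat n n"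
    and r: "\<And>i. i < n \<Longrightarrow> r i < n" "\<And>i. i < n \<Longrightarrow> r (r i) = r i"
  shows "char_poly (lump_mat n r A) = char_poly A"
proof -
  \<comment> \<open>The columns of \<open>P\<close> are the new basis vectors. Its inverse
    \<open>Q\<close> reads off coordinates: a representative keeps its entry, any other index
    \<open>i\<close> gets its entry minus that of \<open>r i\<close>.\<close>
  define P :: "real mat" where
    "P = mat n n (\<lambda>(l, j). if r j = j then of_bool (r l = j) else of_bool (l = j))"
  define Q :: "real mat" where
    "Q = mat n n (\<lambda>(i, j). of_bool (i = j) - of_bool (r i \<noteq> i \<and> j = r i))"
  have P: "P \<in> carrier_mat n n" and Q: "Q \<in> carrier_mat n n"
    by (auto simp: P_def Q_def)
  have right: "(X * P) $$ (i, j) = lump_entry n r X i j"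
    if X: "X \<in> carrier_mat n n" and ij: "i < n" "j < n" for X i j
  proof -
    have "(X * P) $$ (i, j) = (\<Sum>l<n. X $$ (i, l) * (if r j = j then of_bool (r l = j) else of_bool (l = j)))"
      using mult_mat_mat_index[OF X P ij] ij by (simp add: P_def)
    also have "\<dots> = lump_entry n r X i j"
    proof (cases "r j = j")
      case True
      have "(\<Sum>l<n. X $$ (i, l) * of_bool (r l = j)) = (\<Sum>l | l < n \<and> r l = j. X $$ (i, l))"
        by (rule sum.mono_neutral_cong_right) auto
      with True show ?thesis by (simp add: lump_entry_def)
    next
      case False
      have "(\<Sum>l<n. X $$ (i, l) * of_bool (l = j)) = (\<Sum>l<n. if l = j then X $$ (i, l) else 0)"
        by (intro sum.cong) auto
      with False ij show ?thesis by (simp add: lump_entry_def)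
    qed
    finally show ?thesis .
  qed
  have left: "(Q * X) $$ (i, j) = X $$ (i, j) - (if r i = i then 0 else X $$ (r i, j))"
    if X: "X \<in> carrier_mat n n" and ij: "i < n" "j < n" for X i j
  proof -
    have "(Q * X) $$ (i, j)
        = (\<Sum>l<n. (if l = i then X $$ (l, j) else 0) -
                  (if l = r i then (if r i = i then 0 else X $$ (l, j)) else 0))"
      unfolding mult_mat_mat_index[OF Q X ij]
      using ij by (intro sum.cong) (auto simp: Q_def)
    also have "\<dots> = X $$ (i, j) - (if r i = i then 0 else X $$ (r i, j))"
      using ij r(1)[of i] by (simp add: sum_subtractf)
    finally show ?thesis .
  qed
  have QP: "Q * P = 1\<^sub>m n"
  proof (rule eq_matI)
    fix i j assume ij: "i < dim_row (1\<^sub>m n :: real mat)" "j < dim_col (1\<^sub>m n :: real mat)"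
    then show "(Q * P) $$ (i, j) = 1\<^sub>m n $$ (i, j)"
      using left[OF P, of i j] r(1)[of i] r(2)[of i] by (auto simp: P_def split: if_splits)
  qed (use P Q in auto)
  have PQ: "P * Q = 1\<^sub>m n"
    by (rule mat_mult_left_right_inverse[OF Q P QP])
  have "lump_mat n r A = Q * (A * P)"
  proof (rule eq_matI)
    fix i j assume ij: "i < dim_row (Q * (A * P))" "j < dim_col (Q * (A * P))"
    then have ij': "i < n" "j < n" using P Q by auto
    have "A * P \<in> carrier_mat n n" using A P by auto
    from left[OF this ij'] right[OF A] r(1) ij'
    show "lump_mat n r A $$ (i, j) = (Q * (A * P)) $$ (i, j)"
      by (simp add: lump_mat_def)
  qed (use P Q in \<open>auto simp: lump_mat_def\<close>)
  also have "\<dots> = Q * A * P"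
    by (rule assoc_mult_mat[OF Q A P, symmetric])
  finally have *: "lump_mat n r A = Q * A * P" .
  have "similar_mat (lump_mat n r A) A"
  proof (rule similar_matI)
    show "{lump_mat n r A, A, Q, P} \<subseteq> carrier_mat n n"
      using A P Q by (simp add: lump_mat_def)
  qed (rule QP PQ *)+
  then show ?thesis by (rule char_poly_similar)
qed

section \<open>Characteristic polynomials of block triangular and shifted matrices\<close>

text \<open>The characteristic matrix inherits the zero block, so its determinant factors. Both
  positions of the zero block occur when the supra-Laplacian is split.\<close>

lemma char_poly_block_triangular:
  fixes A :: "'a :: idom mat"
  assumes A: "A \<in> carrier_mat (k + l) (k + l)"
    and zero: "(\<forall>i<k. \<forall>j<l. A $$ (i, k + j) = 0) \<or> (\<forall>i<k. \<forall>j<l. A $$ (k + j, i) = 0)"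
  shows "char_poly A = char_poly (mat k k (\<lambda>(i, j). A $$ (i, j)))
                      * char_poly (mat l l (\<lambda>(i, j). A $$ (k + i, k + j)))"
proof -
  let ?M = "char_poly_matrix A"
  let ?A1 = "mat k k (\<lambda>(i, j). ?M $$ (i, j))" and ?A4 = "mat l l (\<lambda>(i, j). ?M $$ (k + i, k + j))"
  let ?A2 = "mat k l (\<lambda>(i, j). ?M $$ (i, k + j))" and ?A3 = "mat l k (\<lambda>(i, j). ?M $$ (k + i, j))"
  have dim: "dim_row ?M = k + l" "dim_col ?M = k + l"
    using A by (auto simp: char_poly_matrix_def)
  have M: "?M = four_block_mat ?A1 ?A2 ?A3 ?A4"
    by (rule eq_matI) (auto simp: dim)
  have 1: "?A1 = char_poly_matrix (mat k k (\<lambda>(i, j). A $$ (i, j)))"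
    and 4: "?A4 = char_poly_matrix (mat l l (\<lambda>(i, j). A $$ (k + i, k + j)))"
    using A by (auto simp: char_poly_matrix_def intro!: eq_matI)
  have "det ?M = det ?A1 * det ?A4"
    using zero
  proof
    assume z: "\<forall>i<k. \<forall>j<l. A $$ (i, k + j) = 0"
    have A2: "?A2 = 0\<^sub>m k l"
      using A z by (intro eq_matI) (simp_all add: char_poly_matrix_def)
    show ?thesis
      by (subst M, rule det_four_block_mat_upper_right_zero[OF mat_carrier A2 mat_carrier mat_carrier])
  next
    assume z: "\<forall>i<k. \<forall>j<l. A $$ (k + j, i) = 0"
    have A3: "?A3 = 0\<^sub>m l k"
      using A z by (intro eq_matI) (simp_all add: char_poly_matrix_def)
    show ?thesis
      by (subst M, rule det_four_block_mat_lower_left_zero[OF mat_carrier mat_carrier A3 mat_carrier])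
  qed
  then show ?thesis unfolding char_poly_def 1 4 .
qed

text \<open>Holds because \<open>A + t I - x I = A - (x - t) I\<close>. Stated for values, since
  later only the roots matter: they move by \<open>t\<close>.\<close>

lemma poly_char_poly_add_scalar:
  fixes A :: "'a :: field mat"
  assumes A: "A \<in> carrier_mat n n"
  shows "poly (char_poly (A + t \<cdot>\<^sub>m 1\<^sub>m n)) x = poly (char_poly A) (x - t)"
proof -
  have "char_matrix (A + t \<cdot>\<^sub>m 1\<^sub>m n) x = char_matrix A (x - t)"
    by (rule eq_matI) (use A in \<open>auto simp: char_matrix_def algebra_simps\<close>)
  moreover have "A + t \<cdot>\<^sub>m 1\<^sub>m n \<in> carrier_mat n n" using A by auto
  ultimately show ?thesis
    using A by (simp add: char_poly_matrix[of _ n])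
qed

lemma char_poly_dim_one: "char_poly (mat 1 1 f :: real mat) = [:- f (0, 0), 1:]"
  unfolding char_poly_def by (subst det_single) (auto simp: char_poly_matrix_def)

section \<open>Splitting off the all-ones kernel vector\<close>

text \<open>If the rows of \<open>A\<close> sum to zero, this is the map that \<open>A\<close>
  induces on the quotient by the all-ones vector, in the classes of the first \<open>k\<close> unit
  vectors; the class of the last unit vector is minus their sum.\<close>

definition deflate_last :: "nat \<Rightarrow> real mat \<Rightarrow> real mat" where
  "deflate_last k A = mat k k (\<lambda>(i, j). A $$ (i, j) - A $$ (k, j))"

definition deflate_first :: "nat \<Rightarrow> real mat \<Rightarrow> real mat" where
  "deflate_first k A = mat k k (\<lambda>(i, j). A $$ (Suc i, Suc j) - A $$ (0, Suc j))"

text \<open>With a single cluster, the lumped column of index \<open>k\<close> is built from the row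
  sums of \<open>A\<close>. Hence it vanishes, and a 1 by 1 zero block splits off.\<close>

lemma char_poly_deflate_last:
  assumes A: "A \<in> carrier_mat (Suc k) (Suc k)"
    and rows: "\<And>i. i \<le> k \<Longrightarrow> (\<Sum>j\<le>k. A $$ (i, j)) = 0"
  shows "char_poly A = [:0, 1:] * char_poly (deflate_last k A)"
proof -
  define T where "T = lump_mat (Suc k) (\<lambda>_. k) A"
  have S: "{l. l < Suc k} = {..k}" by auto
  have T: "T $$ (i, j) = (if j = k then 0 else A $$ (i, j) - (if i = k then 0 else A $$ (k, j)))"
    if "i \<le> k" "j \<le> k" for i j
    using that rows by (auto simp: T_def lump_mat_def lump_entry_def S)
  have "char_poly A = char_poly T"
    unfolding T_def by (rule char_poly_lump_mat[symmetric]) (use A in auto)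
  also have "\<dots> = char_poly (mat k k (\<lambda>(i, j). T $$ (i, j)))
                  * char_poly (mat 1 1 (\<lambda>(i, j). T $$ (k + i, k + j)))"
    by (rule char_poly_block_triangular) (auto simp: T, simp add: T_def lump_mat_def)
  also have "mat k k (\<lambda>(i, j). T $$ (i, j)) = deflate_last k A"
    by (rule eq_matI) (auto simp: deflate_last_def T)
  finally show ?thesis by (simp add: char_poly_dim_one T mult.commute del: One_nat_def)
qed

text \<open>The mirror image, with index 0 as representative. It serves the second layer and also
  the 2 by 2 block that sits between the layers.\<close>

lemma char_poly_deflate_first:
  assumes A: "A \<in> carrier_mat (Suc k) (Suc k)"
    and rows: "\<And>i. i \<le> k \<Longrightarrow> (\<Sum>j\<le>k. A $$ (i, j)) = 0"
  shows "char_poly A = [:0, 1:] * char_poly (deflate_first k A)"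
proof -
  define T where "T = lump_mat (1 + k) (\<lambda>_. 0) A"
  have S: "{l. l < Suc k} = {..k}" by auto
  have T: "T $$ (i, j) = (if j = 0 then 0 else A $$ (i, j) - (if i = 0 then 0 else A $$ (0, j)))"
    if "i \<le> k" "j \<le> k" for i j
    using that rows by (auto simp: T_def lump_mat_def lump_entry_def S)
  have "char_poly A = char_poly T"
    unfolding T_def by (rule char_poly_lump_mat[symmetric]) (use A in auto)
  also have "\<dots> = char_poly (mat 1 1 (\<lambda>(i, j). T $$ (i, j)))
                  * char_poly (mat k k (\<lambda>(i, j). T $$ (1 + i, 1 + j)))"
    by (rule char_poly_block_triangular) (auto simp: T, simp add: T_def lump_mat_def)
  also have "mat k k (\<lambda>(i, j). T $$ (1 + i, 1 + j)) = deflate_first k A"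
    by (rule eq_matI) (auto simp: deflate_first_def T)
  finally show ?thesis by (simp add: char_poly_dim_one T del: One_nat_def)
qed

section \<open>Characteristic polynomial of the supra-Laplacian\<close>

text \<open>Each layer is lumped into one cluster. The interlayer blocks are constant, so
  subtracting the row of the representative cancels them in all other rows. What remains of a layer
  is its deflation plus its scalar term.\<close>

lemma char_poly_supra_laplacian:
  assumes A: "A \<in> carrier_mat (Suc k) (Suc k)" and B: "B \<in> carrier_mat (Suc l) (Suc l)"
    and rowsA: "\<And>i. i \<le> k \<Longrightarrow> (\<Sum>j\<le>k. A $$ (i, j)) = 0"
    and rowsB: "\<And>i. i \<le> l \<Longrightarrow> (\<Sum>j\<le>l. B $$ (i, j)) = 0"
    and n: "n = real (Suc k)" and m: "m = real (Suc l)"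
  shows "char_poly (supra_laplacian A B c) =
    [:0, 1:] * ([:- (c / n + c / m), 1:] *
      (char_poly (deflate_last k A + (c / n) \<cdot>\<^sub>m 1\<^sub>m k) *
       char_poly (deflate_first l B + (c / m) \<cdot>\<^sub>m 1\<^sub>m l)))"
proof -
  let ?N = "k + (2 + l)" and ?L = "supra_laplacian A B c"
  \<comment> \<open>The representatives are the last node of the first layer and the first node of the second
     one, which makes the lumped matrix block triangular without a permutation.\<close>
  define r where "r i = (if i \<le> k then k else Suc k)" for i
  define T where "T = lump_mat ?N r ?L"
  have pos: "n > 0" "m > 0" using n m by auto
  have L: "?L \<in> carrier_mat ?N ?N"
    using A B by (auto simp: supra_laplacian_def Let_def ones_mat_def)
  have L11: "?L $$ (i, j) = A $$ (i, j) + (if i = j then c / n else 0)" if "i \<le> k" "j \<le> k" for i j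
    using A B that by (auto simp: supra_laplacian_def Let_def ones_mat_def n)
  have L12: "?L $$ (i, Suc k + j) = - c / (n * m)" if "i \<le> k" "j \<le> l" for i j
    using A B that by (auto simp: supra_laplacian_def Let_def ones_mat_def n m)
  have L21: "?L $$ (Suc k + i, j) = - c / (n * m)" if "i \<le> l" "j \<le> k" for i j
    using A B that by (auto simp: supra_laplacian_def Let_def ones_mat_def n m)
  have L22: "?L $$ (Suc k + i, Suc k + j) = B $$ (i, j) + (if i = j then c / m else 0)"
    if "i \<le> l" "j \<le> l" for i j
    using A B that by (auto simp: supra_laplacian_def Let_def ones_mat_def m)
  have C1: "{i. i < ?N \<and> r i = k} = {..k}" by (auto simp: r_def)
  have C2: "{i. i < ?N \<and> r i = Suc k} = (+) (Suc k) ` {..l}"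
    by (auto simp: r_def image_def intro: exI[of _ "_ - Suc k"])
      (metis add_Suc atMost_iff le_add_diff_inverse not_less_eq_eq add_le_cancel_left less_Suc_eq_le)
  define e where "e = lump_entry ?N r ?L"
  have E: "e i j =
      (if j = k then \<Sum>s\<le>k. ?L $$ (i, s)
       else if j = Suc k then \<Sum>s\<le>l. ?L $$ (i, Suc k + s) else ?L $$ (i, j))" for i j
  proof -
    have "e i k = (\<Sum>s\<le>k. ?L $$ (i, s))"
      unfolding e_def lump_entry_def C1 by (simp add: r_def)
    moreover have "e i (Suc k) = (\<Sum>s\<le>l. ?L $$ (i, Suc k + s))"
      unfolding e_def lump_entry_def C2 by (subst sum.reindex) (auto simp: r_def)
    moreover have "e i j = ?L $$ (i, j)" if "j \<noteq> k" "j \<noteq> Suc k"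
      using that by (auto simp: e_def lump_entry_def r_def)
    ultimately show ?thesis by simp
  qed
  have s11: "(\<Sum>s\<le>k. ?L $$ (i, s)) = c / n" if "i \<le> k" for i
    using that rowsA[OF that] by (simp add: L11 sum.distrib)
  have s12: "(\<Sum>s\<le>l. ?L $$ (i, Suc k + s)) = - c / n" if "i \<le> k" for i
  proof -
    have "(\<Sum>s\<le>l. ?L $$ (i, Suc k + s)) = (\<Sum>s\<le>l. - c / (n * m))"
      by (rule sum.cong[OF refl]) (use that L12 in blast)
    also have "\<dots> = m * (- c / (n * m))" by (simp add: m)
    also have "\<dots> = - c / n" using pos by simp
    finally show ?thesis .
  qed
  have s21: "(\<Sum>s\<le>k. ?L $$ (Suc k + i, s)) = - c / m" if "i \<le> l" for i
  proof -
    have "(\<Sum>s\<le>k. ?L $$ (Suc k + i, s)) = (\<Sum>s\<le>k. - c / (n * m))"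
      by (rule sum.cong[OF refl]) (use that L21 in blast)
    also have "\<dots> = n * (- c / (n * m))" by (simp add: n)
    also have "\<dots> = - c / m" using pos by simp
    finally show ?thesis .
  qed
  have s22: "(\<Sum>s\<le>l. ?L $$ (Suc k + i, Suc k + s)) = c / m" if "i \<le> l" for i
  proof -
    have "(\<Sum>s\<le>l. ?L $$ (Suc k + i, Suc k + s)) = (\<Sum>s\<le>l. B $$ (i, s) + (if i = s then c / m else 0))"
      by (rule sum.cong[OF refl]) (use that L22 in blast)
    also have "\<dots> = c / m" using that rowsB[OF that] by (simp add: sum.distrib)
    finally show ?thesis .
  qed
  have T: "T $$ (i, j) = e i j
      - (if i = k \<or> i = Suc k then 0 else e (if i < k then k else Suc k) j)"
    if "i < ?N" "j < ?N" for i j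
    using that by (auto simp: T_def e_def lump_mat_def r_def)
  have T11: "T $$ (i, j) = A $$ (i, j) - A $$ (k, j) + (if i = j then c / n else 0)"
    if "i < k" "j < k" for i j
    using that by (simp add: T E L11)
  \<comment> \<open>Rows \<open>i\<close> and \<open>k\<close> of the supra-Laplacian agree on the
    second layer. The columns \<open>j = 0\<close> and \<open>j = 1\<close> belong to the
    representatives and hold sums over a layer, which are the same for all rows of the first
    layer.\<close>
  have T12: "T $$ (i, k + j) = 0" if "i < k" "j < 2 + l" for i j
  proof -
    consider "j = 0" | "j = 1" | j' where "j = Suc (Suc j')" "j' < l"
      using \<open>j < 2 + l\<close> by (metis One_nat_def add_2_eq_Suc less_Suc_eq_0_disj Suc_less_SucD)
    then show ?thesis
    proof cases
      case 3
      then show ?thesis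
        using \<open>i < k\<close> L12[of _ "Suc j'"] by (simp add: T E)
    qed (use that s12 in \<open>simp_all add: T E s11\<close>)
  qed
  \<comment> \<open>The matrix of the supra-Laplacian on the plane of vectors constant on each
    layer.\<close>
  have T22: "T $$ (k, k) = c / n" "T $$ (k, Suc k) = - c / n"
      "T $$ (Suc k, k) = - c / m" "T $$ (Suc k, Suc k) = c / m"
    using s11[of k] s12[of k] s21[of 0] s22[of 0] by (simp_all add: T E)
  have T32: "T $$ (k + (2 + i), k + j) = 0" if "i < l" "j < 2" for i j
  proof -
    consider "j = 0" | "j = 1" using \<open>j < 2\<close> by linarith
    then show ?thesis
      using \<open>i < l\<close> s21[of 0] s21[of "Suc i"] s22[of 0] s22[of "Suc i"]
      by cases (simp_all add: T E)
  qed
  have T33: "T $$ (k + (2 + i), k + (2 + j)) =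
      B $$ (Suc i, Suc j) - B $$ (0, Suc j) + (if i = j then c / m else 0)"
    if "i < l" "j < l" for i j
    using that L22[of "Suc i" "Suc j"] L22[of 0 "Suc j"] by (simp add: T E)
  \<comment> \<open>The block sizes are \<open>k\<close>, 2 and \<open>l\<close>. First
    \<open>T\<close> is split as block lower triangular into \<open>k\<close> and
    \<open>2 + l\<close>, then its corner \<open>M\<close> as block upper triangular into 2 and
    \<open>l\<close>.\<close>
  define M where "M = mat (2 + l) (2 + l) (\<lambda>(i, j). T $$ (k + i, k + j))"
  define S where "S = mat 2 2 (\<lambda>(i, j). M $$ (i, j))"
  have "char_poly ?L = char_poly T"
    unfolding T_def by (rule char_poly_lump_mat[symmetric, OF L]) (auto simp: r_def)
  also have "\<dots> = char_poly (mat k k (\<lambda>(i, j). T $$ (i, j))) * char_poly M"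
    unfolding M_def
    by (rule char_poly_block_triangular) (use T12 in \<open>auto simp: T_def lump_mat_def\<close>)
  also have "mat k k (\<lambda>(i, j). T $$ (i, j)) = deflate_last k A + (c / n) \<cdot>\<^sub>m 1\<^sub>m k"
    by (rule eq_matI) (auto simp: deflate_last_def T11)
  also have "char_poly M = char_poly S * char_poly (mat l l (\<lambda>(i, j). M $$ (2 + i, 2 + j)))"
    unfolding S_def
    by (rule char_poly_block_triangular) (use T32 in \<open>auto simp: M_def\<close>)
  also have "mat l l (\<lambda>(i, j). M $$ (2 + i, 2 + j)) = deflate_first l B + (c / m) \<cdot>\<^sub>m 1\<^sub>m l"
    by (rule eq_matI) (use T33 in \<open>auto simp: deflate_first_def M_def\<close>)
  also have "char_poly S = [:0, 1:] * [:- (c / n + c / m), 1:]"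
  proof -
    have S: "S $$ (0, 0) = c / n" "S $$ (0, 1) = - c / n" "S $$ (1, 0) = - c / m" "S $$ (1, 1) = c / m"
      by (simp_all add: S_def M_def T22)
    \<comment> \<open>The rows of \<open>S\<close> sum to zero as well, so deflation applies once
      more and leaves the trace \<open>c / n + c / m\<close>.\<close>
    have "char_poly S = [:0, 1:] * char_poly (deflate_first 1 S)"
      by (rule char_poly_deflate_first) (use S in \<open>auto simp: S_def le_Suc_eq\<close>)
    then show ?thesis
      using S by (simp add: deflate_first_def char_poly_dim_one del: One_nat_def) (simp add: algebra_simps)
  qed
  finally show ?thesis by (simp add: mult_ac del: mult_pCons_left mult_pCons_right)
qed

section \<open>The second smallest eigenvalue as a least root\<close>

text \<open>Splitting off the factor \<open>x\<close> takes one zero out of the multiset of roots.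
  The other roots are nonnegative, so this zero sorts to position 0 and the least root of
  \<open>q\<close> to position 1.\<close>

lemma algebraic_connectivity_eq_Min:
  assumes A: "char_poly A = [:0, 1:] * q" and q: "q \<noteq> 0"
    and root: "\<exists>x. poly q x = 0" and nonneg: "\<And>x. poly q x = 0 \<Longrightarrow> x \<ge> 0"
  shows "algebraic_connectivity A = Min {x. poly q x = 0}"
proof -
  define xs where "xs = sorted_list_of_multiset (proots q)"
  have set: "set xs = {x. poly q x = 0}" and sorted: "sorted xs"
    using q by (simp_all add: xs_def)
  have "proots [:0, 1 :: real:] = {#0#}"
    using proots_linear_factor[of "0 :: real"] by simp
  then have "proots (char_poly A) = add_mset 0 (proots q)"
    unfolding A using q by (subst proots_mult) auto
  then have "eigenvalues_sorted A = insort 0 xs"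
    by (simp add: eigenvalues_sorted_def xs_def)
  also have "\<dots> = 0 # xs"
    using set nonneg by (intro insort_is_Cons) auto
  finally have "algebraic_connectivity A = xs ! 0"
    by (simp add: algebraic_connectivity_def)
  also have "\<dots> = Min (set xs)"
  proof (cases xs)
    case Nil
    with set root show ?thesis by auto
  next
    case (Cons x ys)
    then show ?thesis using sorted by (auto intro!: Min_eqI[symmetric])
  qed
  finally show ?thesis by (simp add: set)
qed

section \<open>Spectrum of a graph Laplacian\<close>

text \<open>The eigenvalue is a Rayleigh quotient whose numerator is a nonnegative combination of
  squared differences. Complex eigenvectors yield reality and nonnegativity at once.\<close>

lemma weighted_laplacian_eigenvalue_nonneg:
  fixes a :: "nat \<Rightarrow> nat \<Rightarrow> real"
  assumes sym: "\<And>i j. a i j = a j i" and nonneg: "\<And>i j. a i j \<ge> 0"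
    and L: "L = mat n n (\<lambda>(i, j). (if i = j then \<Sum>k<n. a i k else 0) - a i j)"
    and ev: "eigenvalue (map_mat complex_of_real L) z"
  shows "\<exists>x\<ge>0. z = complex_of_real x"
proof -
  obtain v where v: "v \<in> carrier_vec n" "v \<noteq> 0\<^sub>v n" "map_mat complex_of_real L *\<^sub>v v = z \<cdot>\<^sub>v v"
    using ev by (auto simp: eigenvalue_def eigenvector_def L)
  define w where "w i = v $ i" for i
  have row: "(\<Sum>j<n. a i j * (w i - w j)) = z * w i" if i: "i < n" for i
  proof -
    have "z * w i = (map_mat complex_of_real L *\<^sub>v v) $ i"
      unfolding v(3) using v(1) i by (simp add: w_def)
    also have "\<dots> = (\<Sum>j<n. complex_of_real (L $$ (i, j)) * w j)"
      using v(1) i by (simp add: L scalar_prod_def w_def lessThan_atLeast0)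
    also have "\<dots> = (\<Sum>j<n. (if j = i then (\<Sum>k<n. a i k) * w j else 0) - a i j * w j)"
      using i by (intro sum.cong) (auto simp: L algebra_simps)
    also have "\<dots> = (\<Sum>j<n. a i j * (w i - w j))"
      using i by (simp add: sum_subtractf sum_distrib_right right_diff_distrib)
    finally show ?thesis by simp
  qed
  \<comment> \<open>Symmetrising the quadratic form of the eigenvector gives \<open>2 z W = D\<close>.\<close>
  define S where "S = (\<Sum>i<n. \<Sum>j<n. a i j * (cnj (w i) * (w i - w j)))"
  define W where "W = (\<Sum>i<n. (cmod (w i))\<^sup>2)"
  define D where "D = (\<Sum>i<n. \<Sum>j<n. a i j * (cmod (w i - w j))\<^sup>2)"
  have "S = (\<Sum>i<n. cnj (w i) * (\<Sum>j<n. a i j * (w i - w j)))"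
    unfolding S_def by (simp add: sum_distrib_left mult.left_commute)
  also have "\<dots> = (\<Sum>i<n. z * (cnj (w i) * w i))"
    by (intro sum.cong) (auto simp: row)
  also have "\<dots> = z * W"
    by (simp add: W_def sum_distrib_left complex_norm_square mult.commute del: of_real_power)
  finally have 1: "S = z * W" .
  have "S = (\<Sum>j<n. \<Sum>i<n. a i j * (cnj (w i) * (w i - w j)))"
    unfolding S_def by (rule sum.swap)
  also have "\<dots> = (\<Sum>i<n. \<Sum>j<n. a i j * (cnj (w j) * (w j - w i)))"
    by (intro sum.cong refl) (simp add: sym)
  finally have "S + S = (\<Sum>i<n. \<Sum>j<n. a i j * (cnj (w i) * (w i - w j)) + a i j * (cnj (w j) * (w j - w i)))"
    unfolding S_def by (simp add: sum.distrib)
  \<comment> \<open>The two terms at \<open>(i, j)\<close> add up to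
    \<open>a i j * (cnj (w i - w j) * (w i - w j))\<close>.\<close>
  also have "\<dots> = complex_of_real D"
    unfolding D_def by (simp add: complex_norm_square algebra_simps del: of_real_power)
  finally have 2: "2 * S = D" by simp
  have "W \<noteq> 0"
  proof
    assume "W = 0"
    then have "w i = 0" if "i < n" for i
      using that by (auto simp: W_def sum_nonneg_eq_0_iff)
    with v(1,2) show False by (auto simp: w_def)
  qed
  moreover have "W \<ge> 0" by (auto simp: W_def intro: sum_nonneg)
  moreover have "D \<ge> 0" using nonneg by (auto simp: D_def intro!: sum_nonneg)
  moreover have "z = complex_of_real (D / (2 * W))"
    using 1 2 \<open>W \<noteq> 0\<close> by (simp add: field_simps)
  ultimately show ?thesis by (intro exI[of _ "D / (2 * W)"]) auto
qed

text \<open>By the fundamental theorem of algebra a nonconstant \<open>q\<close> has a complex root.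
  It is an eigenvalue of \<open>L\<close>, hence real and nonnegative.\<close>

lemma char_poly_factor_real_root:
  fixes L :: "real mat"
  assumes L: "L \<in> carrier_mat n n"
    and ev: "\<And>z. eigenvalue (map_mat complex_of_real L) z \<Longrightarrow> \<exists>x\<ge>0. z = complex_of_real x"
    and q: "char_poly L = p * q"
  shows "degree q > 0 \<Longrightarrow> \<exists>x. poly q x = 0"
    and "poly q x = 0 \<Longrightarrow> x \<ge> 0"
proof -
  interpret hom: map_poly_comm_ring_hom complex_of_real ..
  have cp: "char_poly (map_mat complex_of_real L) = map_poly complex_of_real p * map_poly complex_of_real q"
  proof -
    have "char_poly (map_mat complex_of_real L) = map_poly complex_of_real (char_poly L)"
      by (rule of_real_hom.char_poly_hom[OF L])
    then show ?thesis unfolding q hom.hom_mult .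
  qed
  have root: "\<exists>x\<ge>0. z = complex_of_real x" if "poly (map_poly complex_of_real q) z = 0" for z
    using that by (intro ev) (subst eigenvalue_root_char_poly[of _ n], use L in \<open>auto simp: cp\<close>)
  show "\<exists>x. poly q x = 0" if "degree q > 0"
  proof -
    have "degree (map_poly complex_of_real q) \<noteq> 0" using that by simp
    then obtain z where z: "poly (map_poly complex_of_real q) z = 0"
      by (metis constant_degree fundamental_theorem_of_algebra)
    with root obtain x where "z = complex_of_real x" by blast
    with z show ?thesis by (auto simp: of_real_hom.poly_map_poly)
  qed
  show "x \<ge> 0" if "poly q x = 0"
  proof -
    have "poly (map_poly complex_of_real q) (complex_of_real x) = 0"
      using that by (simp add: of_real_hom.poly_map_poly)
    from root[OF this] show ?thesis by auto
  qed
qed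

lemma laplacian_weights:
  fixes G :: "(nat, 'e) pre_digraph"
  assumes G: "Digraph.graph G" and V: "verts G = {..<n}"
  shows "\<exists>a :: nat \<Rightarrow> nat \<Rightarrow> real. (\<forall>i j. a i j = a j i \<and> a i j \<ge> 0) \<and>
    laplacian n G = mat n n (\<lambda>(i, j). (if i = j then \<Sum>k<n. a i k else 0) - a i j)"
proof -
  interpret Digraph.graph G by (rule G)
  define a :: "nat \<Rightarrow> nat \<Rightarrow> real" where "a i j = of_bool (i \<rightarrow>\<^bsub>G\<^esub> j)" for i j
  have deg: "real (out_degree G i) = (\<Sum>k<n. a i k)" for i
  proof -
    \<comment> \<open>No two parallel arcs leave \<open>i\<close>, so its out-arcs correspond to its
      neighbours and the degree is a row sum of the 0-1 weights.\<close>
    have inj: "inj_on (head G) (out_arcs G i)"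
      by (rule inj_onI) (auto intro!: no_multi_arcs simp: arc_to_ends_def)
    have "head G ` out_arcs G i = {k. k < n \<and> i \<rightarrow>\<^bsub>G\<^esub> k}"
      using V head_in_verts by (auto simp: arcs_ends_conv image_iff)
    with card_image[OF inj] have "out_degree G i = card {k. k < n \<and> i \<rightarrow>\<^bsub>G\<^esub> k}"
      by (simp add: out_degree_def)
    also have "real \<dots> = (\<Sum>k | k < n \<and> i \<rightarrow>\<^bsub>G\<^esub> k. 1)" by simp
    also have "\<dots> = (\<Sum>k<n. a i k)"
      by (rule sum.mono_neutral_cong_left) (auto simp: a_def)
    finally show ?thesis .
  qed
  have "a i j = a j i \<and> a i j \<ge> 0" for i j
    using sym_arcs by (auto simp: a_def symmetric_def sym_def)
  moreover have "laplacian n G = mat n n (\<lambda>(i, j). (if i = j then \<Sum>k<n. a i k else 0) - a i j)"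
    unfolding laplacian_def degree_mat_def adjacency_mat_def deg
    by (rule eq_matI) (auto simp: a_def)
  ultimately show ?thesis by blast
qed

section \<open>Deflated spectrum of a single layer\<close>

text \<open>Collects the facts about a layer on which the spectral computation rests. The spectrum
  is taken over the complex numbers, so that all complex roots of a factor of the characteristic
  polynomial are known to be real.\<close>

definition nonneg_laplacian :: "nat \<Rightarrow> real mat \<Rightarrow> bool" where
  "nonneg_laplacian n L \<longleftrightarrow> L \<in> carrier_mat n n \<and> (\<forall>i<n. (\<Sum>j<n. L $$ (i, j)) = 0) \<and>
    (\<forall>z. eigenvalue (map_mat complex_of_real L) z \<longrightarrow> (\<exists>x\<ge>0. z = complex_of_real x))"

lemma nonneg_laplacian_laplacian:
  fixes G :: "(nat, 'e) pre_digraph"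
  assumes "Digraph.graph G" and "verts G = {..<n}"
  shows "nonneg_laplacian n (laplacian n G)"
proof -
  obtain a :: "nat \<Rightarrow> nat \<Rightarrow> real" where a: "\<And>i j. a i j = a j i" "\<And>i j. a i j \<ge> 0"
    and L: "laplacian n G = mat n n (\<lambda>(i, j). (if i = j then \<Sum>k<n. a i k else 0) - a i j)"
    using laplacian_weights[OF assms] by blast
  have "(\<Sum>j<n. laplacian n G $$ (i, j)) = 0" if "i < n" for i
    using that by (simp add: L sum_subtractf)
  moreover have "laplacian n G \<in> carrier_mat n n" by (simp add: L)
  ultimately show ?thesis
    using weighted_laplacian_eigenvalue_nonneg[OF a L] by (auto simp: nonneg_laplacian_def)
qed

text \<open>The degree of \<open>q\<close> is \<open>k\<close>, so \<open>k \<ge> 1\<close> provides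
  a root. The factor is kept arbitrary so as to fit both deflations.\<close>

lemma nonneg_laplacian_factor:
  assumes L: "nonneg_laplacian (Suc k) L" and k: "k \<ge> 1" and q: "char_poly L = [:0, 1:] * q"
  shows "q \<noteq> 0" and "\<exists>x. poly q x = 0" and "poly q x = 0 \<Longrightarrow> x \<ge> 0"
    and "algebraic_connectivity L = Min {x. poly q x = 0}"
proof -
  have carrier: "L \<in> carrier_mat (Suc k) (Suc k)"
    and ev: "\<And>z. eigenvalue (map_mat complex_of_real L) z \<Longrightarrow> \<exists>x\<ge>0. z = complex_of_real x"
    using L by (auto simp: nonneg_laplacian_def)
  have deg: "degree (char_poly L) = Suc k"
    using degree_monic_char_poly[OF carrier] by simp
  then show "q \<noteq> 0" by (auto simp: q)
  with deg have "degree q = k"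
    unfolding q by (subst (asm) degree_mult_eq) auto
  with k show root: "\<exists>x. poly q x = 0"
    using char_poly_factor_real_root(1)[OF carrier ev q] by simp
  show nonneg: "poly q x = 0 \<Longrightarrow> x \<ge> 0" for x
    by (rule char_poly_factor_real_root(2)[OF carrier ev q])
  show "algebraic_connectivity L = Min {x. poly q x = 0}"
    by (rule algebraic_connectivity_eq_Min[OF q \<open>q \<noteq> 0\<close> root nonneg])
qed

lemma algebraic_connectivity_nonneg:
  assumes "nonneg_laplacian n L" and "n \<ge> 2"
  shows "algebraic_connectivity L \<ge> 0"
proof -
  obtain k where n: "n = Suc k" and k: "k \<ge> 1" using \<open>n \<ge> 2\<close> by (cases n) auto
  let ?q = "deflate_last k L"
  have L: "nonneg_laplacian (Suc k) L" using assms n by simp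
  then have q: "char_poly L = [:0, 1:] * char_poly ?q"
    by (intro char_poly_deflate_last) (auto simp: nonneg_laplacian_def less_Suc_eq_le lessThan_Suc_atMost)
  note f = nonneg_laplacian_factor[OF L k q]
  have "Min {x. poly (char_poly ?q) x = 0} \<in> {x. poly (char_poly ?q) x = 0}"
    using f(1,2) by (intro Min_in) (auto simp: poly_roots_finite)
  with f(3,4) show ?thesis by auto
qed

section \<open>Algebraic connectivity of the supra-Laplacian\<close>

text \<open>Once a factor \<open>x\<close> is removed, the roots are \<open>c / n + c / m\<close>
  and the deflated roots of the two layers, shifted by \<open>c / n\<close> and
  \<open>c / m\<close>. They are nonnegative as \<open>c \<ge> 0\<close>, so the connectivity is the
  least of them.\<close>

lemma algebraic_connectivity_supra_laplacian:
  assumes L1: "nonneg_laplacian n L1" and n: "n \<ge> 2"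
    and L2: "nonneg_laplacian m L2" and m: "m \<ge> 2" and c: "c \<ge> 0"
  shows "algebraic_connectivity (supra_laplacian L1 L2 c) =
    min (c / real n + c / real m)
      (min (algebraic_connectivity L1 + c / real n) (algebraic_connectivity L2 + c / real m))"
proof -
  obtain k where k: "n = Suc k" "k \<ge> 1" using n by (cases n) auto
  obtain l where l: "m = Suc l" "l \<ge> 1" using m by (cases m) auto
  define q1 where "q1 = char_poly (deflate_last k L1)"
  define q2 where "q2 = char_poly (deflate_first l L2)"
  define q1' where "q1' = char_poly (deflate_last k L1 + (c / real n) \<cdot>\<^sub>m 1\<^sub>m k)"
  define q2' where "q2' = char_poly (deflate_first l L2 + (c / real m) \<cdot>\<^sub>m 1\<^sub>m l)"
  define q where "q = [:- (c / real n + c / real m), 1:] * (q1' * q2')"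
  have C: "L1 \<in> carrier_mat (Suc k) (Suc k)" "L2 \<in> carrier_mat (Suc l) (Suc l)"
    "\<And>i. i \<le> k \<Longrightarrow> (\<Sum>j\<le>k. L1 $$ (i, j)) = 0" "\<And>i. i \<le> l \<Longrightarrow> (\<Sum>j\<le>l. L2 $$ (i, j)) = 0"
    using L1 L2 k l by (auto simp: nonneg_laplacian_def less_Suc_eq_le lessThan_Suc_atMost)
  note f1 = nonneg_laplacian_factor[OF L1[unfolded k] k(2) char_poly_deflate_last[OF C(1,3)], folded q1_def]
  note f2 = nonneg_laplacian_factor[OF L2[unfolded l] l(2) char_poly_deflate_first[OF C(2,4)], folded q2_def]
  have p1: "poly q1' x = poly q1 (x - c / real n)" for x
    unfolding q1_def q1'_def by (rule poly_char_poly_add_scalar) (simp add: deflate_last_def)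
  have p2: "poly q2' x = poly q2 (x - c / real m)" for x
    unfolding q2_def q2'_def by (rule poly_char_poly_add_scalar) (simp add: deflate_first_def)
  let ?R1 = "{x. poly q1 x = 0}" and ?R2 = "{x. poly q2 x = 0}"
  let ?S1 = "(\<lambda>x. x + c / real n) ` ?R1" and ?S2 = "(\<lambda>x. x + c / real m) ` ?R2"
  have fin: "finite ?R1" "finite ?R2" and ne: "?R1 \<noteq> {}" "?R2 \<noteq> {}"
    using f1(1,2) f2(1,2) by (auto simp: poly_roots_finite)
  have roots: "{x. poly q x = 0} = insert (c / real n + c / real m) (?S1 \<union> ?S2)"
  proof -
    have "?S1 = {x. poly q1' x = 0}" "?S2 = {x. poly q2' x = 0}"
      by (force simp: p1 p2 image_iff intro: exI[of _ "_ - c / _"])+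
    then show ?thesis by (auto simp: q_def simp del: mult_pCons_left)
  qed
  have "char_poly (supra_laplacian L1 L2 c) = [:0, 1:] * q"
    unfolding q_def q1'_def q2'_def k(1) l(1) by (rule char_poly_supra_laplacian[OF C refl refl])
  moreover have "q \<noteq> 0"
  proof
    assume "q = 0"
    then have "{x. poly q x = 0} = UNIV" by simp
    moreover have "finite {x. poly q x = 0}" unfolding roots using fin by simp
    ultimately show False by (simp add: infinite_UNIV_char_0)
  qed
  moreover have "\<exists>x. poly q x = 0" using roots by blast
  moreover have "x \<ge> 0" if "poly q x = 0" for x
  proof -
    have "x \<in> insert (c / real n + c / real m) (?S1 \<union> ?S2)" using that roots by blast
    then show ?thesis using f1(3) f2(3) c by auto
  qed
  ultimately have "algebraic_connectivity (supra_laplacian L1 L2 c) = Min {x. poly q x = 0}"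
    by (rule algebraic_connectivity_eq_Min)
  also have "\<dots> = min (c / real n + c / real m) (min (Min ?S1) (Min ?S2))"
    unfolding roots using fin ne by (simp add: Min_Un)
  also have "Min ?S1 = Min ?R1 + c / real n"
    using fin ne by (intro mono_Min_commute[symmetric]) (auto simp: mono_def)
  also have "Min ?S2 = Min ?R2 + c / real m"
    using fin ne by (intro mono_Min_commute[symmetric]) (auto simp: mono_def)
  finally show ?thesis by (simp only: f1(4) f2(4))
qed

section \<open>Thresholds for super-diffusion\<close>

theorem mainTheorem7:
  fixes G1 :: "(nat, 'e) pre_digraph" and G2 :: "(nat, 'f) pre_digraph"
    and n m :: nat and L1 L2 :: "real mat" and lam1 lam2 :: real
  assumes "Digraph.graph G1" and "Digraph_Component.connected G1" and "verts G1 = {..<n}" and "n \<ge> 2"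
    and "Digraph.graph G2" and "Digraph_Component.connected G2" and "verts G2 = {..<m}" and "m \<ge> 2"
    and "L1 = laplacian n G1" and "L2 = laplacian m G2"
    and "lam1 = algebraic_connectivity L1" and "lam2 = algebraic_connectivity L2"
    and "lam1 > lam2"
  shows
    "(\<exists>c0\<ge>0. \<forall>c\<ge>c0. super_diffusion L1 L2 c) \<and>
     ((n > m \<and> lam1 / real n > lam2 / real m) \<or> n < m \<longrightarrow>
       (let c_star = real n * lam2 in
         (\<exists>c. 0 \<le> c \<and> c \<le> c_star \<and> super_diffusion L1 L2 c) \<longleftrightarrow>
           lam2 / real m < lam1 / real n \<and>
           lam1 / real n < (1 / real n + 1 / real m) * lam2)) \<and>
     (n > m \<and> lam1 / real n < lam2 / real m \<longrightarrow>
       (let c_star = real m * lam1 in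
         (\<exists>c. 0 \<le> c \<and> c \<le> c_star \<and> super_diffusion L1 L2 c) \<longleftrightarrow>
           lam1 / real n < lam2 / real m \<and>
           lam2 / real m < (1 / real n + 1 / real m) * lam1))"
proof -
  have P1: "nonneg_laplacian n L1" and P2: "nonneg_laplacian m L2"
    using assms by (auto intro: nonneg_laplacian_laplacian)
  define N M where "N = real n" and "M = real m"
  have N: "N \<ge> 2" and M: "M \<ge> 2" using assms by (auto simp: N_def M_def)
  have lam1: "lam1 \<ge> 0" and lam2: "lam2 \<ge> 0"
    using algebraic_connectivity_nonneg P1 P2 assms by auto
  \<comment> \<open>The maximum of the two connectivities is \<open>lam1\<close>. Of the three terms
    of the minimum, \<open>lam1 + c / N\<close> exceeds it as soon as \<open>c > 0\<close>, which
    the first condition forces because \<open>lam1 \<ge> 0\<close>.\<close>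
  have sd: "super_diffusion L1 L2 c \<longleftrightarrow> lam1 < c / N + c / M \<and> lam1 < lam2 + c / M"
    if c: "c \<ge> 0" for c
  proof -
    have "lam1 < lam1 + c / N" if "lam1 < c / N + c / M"
    proof -
      have "c \<noteq> 0" using that lam1 by auto
      with c N show ?thesis by simp
    qed
    then show ?thesis
      using algebraic_connectivity_supra_laplacian[OF P1 assms(4) P2 assms(8) c] \<open>lam1 > lam2\<close>
      unfolding super_diffusion_def N_def M_def assms(11,12)[symmetric] by auto
  qed
  have upto: "(\<exists>c. 0 \<le> c \<and> c \<le> b \<and> super_diffusion L1 L2 c) \<longleftrightarrow>
      lam1 < b / N + b / M \<and> lam1 < lam2 + b / M" if b: "b \<ge> 0" for b
  proof
    assume "\<exists>c. 0 \<le> c \<and> c \<le> b \<and> super_diffusion L1 L2 c"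
    then obtain c where c: "0 \<le> c" "c \<le> b" "super_diffusion L1 L2 c" by blast
    have "c / N \<le> b / N" "c / M \<le> b / M" using c N M by (auto intro: divide_right_mono)
    with c sd show "lam1 < b / N + b / M \<and> lam1 < lam2 + b / M" by force
  qed (use b sd in auto)
  \<comment> \<open>This bound gives \<open>c / M \<ge> lam1 + 1\<close>, so \<open>c / M\<close>
    alone exceeds \<open>lam1\<close> in both conditions of \<open>sd\<close>.\<close>
  have "super_diffusion L1 L2 c" if c: "c \<ge> M * (lam1 + 1)" for c
  proof -
    have "c \<ge> 0" using that M lam1 by (meson mult_nonneg_nonneg order_trans add_nonneg_nonneg zero_le_one zero_le_numeral)
    moreover have "lam1 + 1 \<le> c / M" using c M by (simp add: field_simps)
    moreover have "c / N \<ge> 0" using \<open>c \<ge> 0\<close> N by simp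
    ultimately show ?thesis using sd lam2 by auto
  qed
  moreover have "M * (lam1 + 1) \<ge> 0" using M lam1 by simp
  ultimately have i: "\<exists>c0\<ge>0. \<forall>c\<ge>c0. super_diffusion L1 L2 c" by blast
  have ii: "(\<exists>c. 0 \<le> c \<and> c \<le> N * lam2 \<and> super_diffusion L1 L2 c) \<longleftrightarrow>
      lam2 / M < lam1 / N \<and> lam1 / N < (1 / N + 1 / M) * lam2"
    if h: "(n > m \<and> lam1 / N > lam2 / M) \<or> n < m"
  proof -
    \<comment> \<open>The first inequality already follows from \<open>h\<close>, so the criterion
      reduces to the second one.\<close>
    have "lam2 / M < lam1 / N"
      using h
    proof
      assume "n < m"
      then have "N < M" by (simp add: N_def M_def)
      then have "lam2 / M \<le> lam2 / N" using lam2 N by (intro divide_left_mono) auto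
      also have "\<dots> < lam1 / N" using \<open>lam1 > lam2\<close> N by (simp add: divide_strict_right_mono)
      finally show ?thesis .
    qed simp
    \<comment> \<open>At \<open>c = N * lam2\<close> the term \<open>c / N\<close> equals
      \<open>lam2\<close>, so the two conditions of \<open>upto\<close> coincide. Multiplying the
      second inequality by \<open>N\<close> gives the same condition.\<close>
    moreover have "lam1 / N < (1 / N + 1 / M) * lam2 \<longleftrightarrow> lam1 < lam2 + N * lam2 / M"
      using N M by (simp add: field_simps)
    moreover have "N * lam2 / N = lam2" using N by simp
    ultimately show ?thesis
      using upto[of "N * lam2"] N lam2 by auto
  qed
  have iii: "(\<exists>c. 0 \<le> c \<and> c \<le> M * lam1 \<and> super_diffusion L1 L2 c) \<longleftrightarrow>
      lam1 / N < lam2 / M \<and> lam2 / M < (1 / N + 1 / M) * lam1"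
    if h: "lam1 / N < lam2 / M"
  proof -
    \<comment> \<open>Under \<open>h\<close> both sides of the equivalence are true. At
      \<open>c = M * lam1\<close> the term \<open>c / M\<close> equals \<open>lam1\<close>, and the
      conditions of \<open>upto\<close> reduce to \<open>lam1 > 0\<close> and
      \<open>lam2 > 0\<close>; on the right, \<open>lam2 / M < lam1 / M\<close> suffices.\<close>
    have "0 \<le> lam1 / N" using lam1 N by simp
    then have "0 < lam2 / M" using h by simp
    then have pos: "lam2 > 0" using M by (simp add: zero_less_divide_iff)
    have "M * lam1 / M = lam1" using M by simp
    moreover have "0 < M * lam1 / N" using M N pos \<open>lam1 > lam2\<close> by simp
    moreover have "lam2 / M < lam1 / M" using \<open>lam1 > lam2\<close> M by (simp add: divide_strict_right_mono)
    then have "lam2 / M < (1 / N + 1 / M) * lam1"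
      using \<open>0 \<le> lam1 / N\<close> by (simp add: distrib_right)
    ultimately show ?thesis
      using upto[of "M * lam1"] M lam1 pos h by auto
  qed
  show ?thesis
    using i ii iii unfolding Let_def N_def M_def by blast
qed

end
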